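(* For a group $G$ the following properties are equivalent: (i) $G$ can be endowed with a compatible semiorder distinct from the equality relation; (ii) $G$ can be endowed with a compatible weak order distinct from the equality relation; (iii) $G$ has a proper normal subgroup $H$ whose quotient $G/H$ is totally orderable.
   Context: Groups are not assumed abelian. A partial order on a group is compatible if it is preserved by all left and right translations; a group is totally orderable if it admits a compatible total order. For positive integers $r,s$, $r\oplus s$ is the disjoint union of an $r$-element chain and an $s$-element chain with no comparabilities between them; embedding of posets means a one-to-one map $f$ with $f(x)\leq f(y)$ iff $x\leq y$. An order is a semiorder if it embeds neither $2\oplus 2$ nor $3\oplus 1$; it is a weak order if it does not embed $1\oplus 2$. *)

theory Defs
  imports "HOL-Algebra.Coset"
begin

text \<open>
  A poset is a carrier set \<open>A\<close> with a reflexive order relation \<open>r \<subseteq> A \<times> A\<close>, as in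
  \<open>partial_order_on A r\<close>; the equality relation on \<open>A\<close> is then \<open>Id_on A\<close>.
\<close>

definition poset_embeds :: "'a set \<Rightarrow> 'a rel \<Rightarrow> 'b set \<Rightarrow> 'b rel \<Rightarrow> bool"
  where "poset_embeds A r B s \<longleftrightarrow>
    (\<exists>f. inj_on f A \<and> f ` A \<subseteq> B \<and> (\<forall>x\<in>A. \<forall>y\<in>A. (f x, f y) \<in> s \<longleftrightarrow> (x, y) \<in> r))"

text \<open>
  The poset \<open>m \<oplus> n\<close>: the disjoint union of the chains \<open>{..<m}\<close> and \<open>{..<n}\<close>, with
  no comparabilities between the two summands.
\<close>

definition chain_sum_carrier :: "nat \<Rightarrow> nat \<Rightarrow> (nat + nat) set"
  where "chain_sum_carrier m n = {..<m} <+> {..<n}"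

definition chain_sum_order :: "nat \<Rightarrow> nat \<Rightarrow> (nat + nat) rel"
  where "chain_sum_order m n =
    {(Inl i, Inl j) |i j. i \<le> j \<and> j < m} \<union> {(Inr i, Inr j) |i j. i \<le> j \<and> j < n}"

definition embeds_chain_sum :: "nat \<Rightarrow> nat \<Rightarrow> 'a set \<Rightarrow> 'a rel \<Rightarrow> bool"
  where "embeds_chain_sum m n A r \<longleftrightarrow>
    poset_embeds (chain_sum_carrier m n) (chain_sum_order m n) A r"

definition semiorder_on :: "'a set \<Rightarrow> 'a rel \<Rightarrow> bool"
  where "semiorder_on A r \<longleftrightarrow>
    partial_order_on A r \<and> \<not> embeds_chain_sum 2 2 A r \<and> \<not> embeds_chain_sum 3 1 A r"

definition weak_order_on :: "'a set \<Rightarrow> 'a rel \<Rightarrow> bool"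
  where "weak_order_on A r \<longleftrightarrow> partial_order_on A r \<and> \<not> embeds_chain_sum 1 2 A r"

definition compatible_order :: "('a, 'b) monoid_scheme \<Rightarrow> 'a rel \<Rightarrow> bool"
  where "compatible_order G r \<longleftrightarrow>
    partial_order_on (carrier G) r \<and>
    (\<forall>x\<in>carrier G. \<forall>y\<in>carrier G. \<forall>z\<in>carrier G. (x, y) \<in> r \<longrightarrow>
      (z \<otimes>\<^bsub>G\<^esub> x, z \<otimes>\<^bsub>G\<^esub> y) \<in> r \<and> (x \<otimes>\<^bsub>G\<^esub> z, y \<otimes>\<^bsub>G\<^esub> z) \<in> r)"

definition totally_orderable :: "('a, 'b) monoid_scheme \<Rightarrow> bool"
  where "totally_orderable G \<longleftrightarrow>
    (\<exists>r. compatible_order G r \<and> linear_order_on (carrier G) r)"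

end

theory Submission
  imports Defs
begin

text \<open>
  The proof is a cycle. A weak order is a semiorder because \<open>1 \<oplus> 2\<close> sits inside both
  \<open>2 \<oplus> 2\<close> and \<open>3 \<oplus> 1\<close>.

  The real content is the passage from a semiorder to a totally orderable quotient. A semiorder
  determines its trace: \<open>x\<close> lies below \<open>y\<close> when everything strictly below \<open>x\<close> is strictly below
  \<open>y\<close> and everything strictly above \<open>y\<close> is strictly above \<open>x\<close>. The two forbidden sums are exactly
  what makes this preorder total (\<open>trace_preorder_total\<close>). The trace is defined from the
  order alone, so it inherits invariance under all translations, and it separates \<open>x\<close> from \<open>y\<close>
  whenever \<open>x < y\<close>. In a group, the elements equivalent to \<open>\<one>\<close> under a translation-invariant
  total preorder form a normal subgroup whose cosets are the equivalence classes, so the quotient is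
  totally ordered (\<open>totally_orderable_quotient_of_preorder\<close>).

  Conversely, a total order on \<open>G/H\<close> pulls back to \<open>G\<close> by leaving distinct elements of
  one coset incomparable. Incomparability or equality is then membership in the same coset, and
  the transitivity of this relation excludes \<open>1 \<oplus> 2\<close>.
\<close>

section \<open>Embedding sums of chains\<close>

lemma embeds_chain_sumE:
  assumes "embeds_chain_sum m n A r"
  obtains f where "inj_on f (chain_sum_carrier m n)" "f ` chain_sum_carrier m n \<subseteq> A"
    "\<And>x y. x \<in> chain_sum_carrier m n \<Longrightarrow> y \<in> chain_sum_carrier m n \<Longrightarrow>
      (f x, f y) \<in> r \<longleftrightarrow> (x, y) \<in> chain_sum_order m n"
proof -
  from assms obtain f where "inj_on f (chain_sum_carrier m n) \<and> f ` chain_sum_carrier m n \<subseteq> A \<and>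
    (\<forall>x\<in>chain_sum_carrier m n. \<forall>y\<in>chain_sum_carrier m n.
      (f x, f y) \<in> r \<longleftrightarrow> (x, y) \<in> chain_sum_order m n)"
    unfolding embeds_chain_sum_def poset_embeds_def ..
  then show thesis
    by (intro that[of f]) auto
qed

lemma embeds_chain_sumI:
  assumes "inj_on f (chain_sum_carrier m n)" "f ` chain_sum_carrier m n \<subseteq> A"
    and "\<And>x y. x \<in> chain_sum_carrier m n \<Longrightarrow> y \<in> chain_sum_carrier m n \<Longrightarrow>
      (f x, f y) \<in> r \<longleftrightarrow> (x, y) \<in> chain_sum_order m n"
  shows "embeds_chain_sum m n A r"
  unfolding embeds_chain_sum_def poset_embeds_def using assms by (intro exI[of _ f]) simp

lemma embeds_chain_sum_mono:
  assumes "embeds_chain_sum m n A r" "m' \<le> m" "n' \<le> n"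
  shows "embeds_chain_sum m' n' A r"
proof -
  obtain f where f: "inj_on f (chain_sum_carrier m n)" "f ` chain_sum_carrier m n \<subseteq> A"
    "\<And>x y. x \<in> chain_sum_carrier m n \<Longrightarrow> y \<in> chain_sum_carrier m n \<Longrightarrow>
      (f x, f y) \<in> r \<longleftrightarrow> (x, y) \<in> chain_sum_order m n"
    using assms(1) by (rule embeds_chain_sumE) (rule that)
  have sub: "chain_sum_carrier m' n' \<subseteq> chain_sum_carrier m n"
    using assms(2,3) by (auto simp: chain_sum_carrier_def)
  have ord: "(x, y) \<in> chain_sum_order m' n' \<longleftrightarrow> (x, y) \<in> chain_sum_order m n"
    if "x \<in> chain_sum_carrier m' n'" "y \<in> chain_sum_carrier m' n'" for x y
    using that assms(2,3) by (auto simp: chain_sum_carrier_def chain_sum_order_def)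
  have "inj_on f (chain_sum_carrier m' n')"
    using f(1) sub by (rule inj_on_subset)
  moreover have "f ` chain_sum_carrier m' n' \<subseteq> A"
    using f(2) sub by blast
  moreover have "(f x, f y) \<in> r \<longleftrightarrow> (x, y) \<in> chain_sum_order m' n'"
    if "x \<in> chain_sum_carrier m' n'" "y \<in> chain_sum_carrier m' n'" for x y
    using f(3)[of x y] ord[OF that] that sub by blast
  ultimately show ?thesis
    by (rule embeds_chain_sumI)
qed

lemma embeds_chain_sum_swap:
  assumes "embeds_chain_sum m n A r"
  shows "embeds_chain_sum n m A r"
proof -
  define sw :: "nat + nat \<Rightarrow> nat + nat" where "sw = case_sum Inr Inl"
  obtain f where f: "inj_on f (chain_sum_carrier m n)" "f ` chain_sum_carrier m n \<subseteq> A"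
    "\<And>x y. x \<in> chain_sum_carrier m n \<Longrightarrow> y \<in> chain_sum_carrier m n \<Longrightarrow>
      (f x, f y) \<in> r \<longleftrightarrow> (x, y) \<in> chain_sum_order m n"
    using assms by (rule embeds_chain_sumE) (rule that)
  have img: "sw ` chain_sum_carrier n m = chain_sum_carrier m n"
    by (force simp: sw_def chain_sum_carrier_def image_iff split: sum.splits)
  have "inj_on sw (chain_sum_carrier n m)"
    by (auto simp: inj_on_def sw_def split: sum.splits)
  then have "inj_on (f \<circ> sw) (chain_sum_carrier n m)"
    using f(1) img by (simp add: comp_inj_on)
  moreover have "(f \<circ> sw) ` chain_sum_carrier n m \<subseteq> A"
    using f(2) img by (simp only: image_comp[symmetric])
  moreover have "((f \<circ> sw) x, (f \<circ> sw) y) \<in> r \<longleftrightarrow> (x, y) \<in> chain_sum_order n m"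
    if "x \<in> chain_sum_carrier n m" "y \<in> chain_sum_carrier n m" for x y
  proof -
    have "(sw x, sw y) \<in> chain_sum_order m n \<longleftrightarrow> (x, y) \<in> chain_sum_order n m"
      using that by (auto simp: sw_def chain_sum_carrier_def chain_sum_order_def)
    then show ?thesis
      using f(3)[of "sw x" "sw y"] that img by auto
  qed
  ultimately show ?thesis
    by (rule embeds_chain_sumI)
qed

lemma weak_order_on_imp_semiorder_on:
  assumes "weak_order_on A r"
  shows "semiorder_on A r"
  using assms embeds_chain_sum_mono[of 2 2 A r 1 2]
    embeds_chain_sum_mono[OF embeds_chain_sum_swap[of 3 1 A r], of 1 2]
  by (auto simp: weak_order_on_def semiorder_on_def)

text \<open>
  Reduces the construction of an embedding to listing the images of the two chains. Sortedness is
  required for the strict order, so repetitions are excluded and injectivity follows from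
  antisymmetry.
\<close>

lemma embeds_chain_sum_listsI:
  assumes po: "partial_order_on A r"
    and A: "set xs \<subseteq> A" "set ys \<subseteq> A"
    and xs: "sorted_wrt (\<lambda>x y. (x, y) \<in> r - Id) xs"
    and ys: "sorted_wrt (\<lambda>x y. (x, y) \<in> r - Id) ys"
    and inc: "\<And>x y. x \<in> set xs \<Longrightarrow> y \<in> set ys \<Longrightarrow> (x, y) \<notin> r \<and> (y, x) \<notin> r"
  shows "embeds_chain_sum (length xs) (length ys) A r"
proof -
  let ?C = "chain_sum_carrier (length xs) (length ys)"
  define f where "f = case_sum ((!) xs) ((!) ys)"
  have chain: "(zs ! i, zs ! j) \<in> r \<longleftrightarrow> i \<le> j"
    if zs: "sorted_wrt (\<lambda>x y. (x, y) \<in> r - Id) zs" "set zs \<subseteq> A"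
      and ij: "i < length zs" "j < length zs" for zs i j
  proof (cases i j rule: linorder_cases)
    case less
    then show ?thesis using sorted_wrt_nth_less[OF zs(1)] ij by auto
  next
    case equal
    then show ?thesis
      using po zs(2) nth_mem[OF ij(1)]
      by (auto simp: partial_order_on_def preorder_on_def refl_on_def)
  next
    case greater
    then have "(zs ! j, zs ! i) \<in> r - Id" using sorted_wrt_nth_less[OF zs(1)] ij by auto
    then show ?thesis
      using po greater by (auto simp: partial_order_on_def antisym_def)
  qed
  have iff: "(f x, f y) \<in> r \<longleftrightarrow> (x, y) \<in> chain_sum_order (length xs) (length ys)"
    if "x \<in> ?C" "y \<in> ?C" for x y
    using that chain[OF xs A(1)] chain[OF ys A(2)] inc
    by (auto simp: chain_sum_carrier_def chain_sum_order_def f_def)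
  have "f ` ?C \<subseteq> A"
    using A by (auto simp: chain_sum_carrier_def f_def)
  moreover have "inj_on f ?C"
  proof (rule inj_onI)
    fix x y assume xy: "x \<in> ?C" "y \<in> ?C" "f x = f y"
    then have "(f x, f y) \<in> r" "(f y, f x) \<in> r"
      using \<open>f ` ?C \<subseteq> A\<close> po by (auto simp: partial_order_on_def preorder_on_def refl_on_def)
    then have "(x, y) \<in> chain_sum_order (length xs) (length ys)"
      "(y, x) \<in> chain_sum_order (length xs) (length ys)"
      using iff[of x y] iff[of y x] xy(1,2) by blast+
    then show "x = y"
      by (auto simp: chain_sum_order_def)
  qed
  ultimately show ?thesis
    using iff by (intro embeds_chain_sumI)
qed

section \<open>The trace of a semiorder\<close>

definition trace_preorder :: "'a set \<Rightarrow> 'a rel \<Rightarrow> 'a rel"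
  where "trace_preorder A r = {(x, y) \<in> A \<times> A.
    (\<forall>z. (z, x) \<in> r - Id \<longrightarrow> (z, y) \<in> r - Id) \<and> (\<forall>z. (y, z) \<in> r - Id \<longrightarrow> (x, z) \<in> r - Id)}"

text \<open>
  Suppose that neither \<open>x\<close> nor \<open>y\<close> is below the other. Each failure has a witness, either below or
  above. If both witnesses are below (\<open>a < x\<close> but not \<open>a < y\<close>, and \<open>b < y\<close> but not \<open>b < x\<close>), the
  chains \<open>a < x\<close> and \<open>b < y\<close> form \<open>2 \<oplus> 2\<close>; dually if both are above. If they are on opposite
  sides, then one of the two elements, say \<open>y\<close>, is the middle of a chain \<open>a < y < b\<close> with neither
  \<open>a < x\<close> nor \<open>x < b\<close>, and \<open>x\<close> completes it to \<open>3 \<oplus> 1\<close>.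
\<close>

lemma trace_preorder_total:
  assumes semi: "semiorder_on A r" and xy: "x \<in> A" "y \<in> A"
  shows "(x, y) \<in> trace_preorder A r \<or> (y, x) \<in> trace_preorder A r"
proof -
  let ?s = "r - Id"
  have po: "partial_order_on A r" and no22: "\<not> embeds_chain_sum 2 2 A r"
    and no31: "\<not> embeds_chain_sum 3 1 A r"
    using semi by (auto simp: semiorder_on_def)
  have carr: "a \<in> A \<and> b \<in> A" if "(a, b) \<in> r" for a b
    using po that by (auto simp: partial_order_on_def preorder_on_def)
  have tr: "(a, c) \<in> r" if "(a, b) \<in> r" "(b, c) \<in> r" for a b c
    using po that by (meson partial_order_on_def preorder_on_def transD)
  have as: "a = b" if "(a, b) \<in> r" "(b, a) \<in> r" for a b
    using po that by (meson partial_order_on_def antisymD)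
  \<comment> \<open>The two forbidden sums in positive form: two strict chains are linked, and a point not
    above the bottom of a three-element chain lies below its top.\<close>
  have two_two: "(a, d) \<in> ?s \<or> (c, b) \<in> ?s" if "(a, b) \<in> ?s" "(c, d) \<in> ?s" for a b c d
  proof (rule ccontr)
    assume "\<not> ?thesis"
    then have "(a, d) \<notin> r" "(c, b) \<notin> r"
      using that tr as by blast+
    then have "u \<in> {a, b} \<Longrightarrow> v \<in> {c, d} \<Longrightarrow> (u, v) \<notin> r \<and> (v, u) \<notin> r" for u v
      using that tr[of a b] tr[of c d] tr[of a c d] tr[of c a b] by blast
    then have "embeds_chain_sum 2 2 A r"
      using embeds_chain_sum_listsI[OF po, of "[a, b]" "[c, d]"] that carr by (auto simp: numeral_2_eq_2)
    with no22 show False ..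
  qed
  have three_one: "(a, d) \<in> ?s \<or> (d, c) \<in> ?s" if "(a, b) \<in> ?s" "(b, c) \<in> ?s" "d \<in> A" for a b c d
  proof (rule ccontr)
    assume "\<not> ?thesis"
    then have "(a, d) \<notin> r" "(d, c) \<notin> r"
      using that tr as by blast+
    then have "u \<in> {a, b, c} \<Longrightarrow> (u, d) \<notin> r \<and> (d, u) \<notin> r" for u
      using that tr[of a b] tr[of a c d] tr[of d a c] tr[of d b c] by blast
    moreover have "(a, c) \<in> ?s"
      using that tr[of a b c] as[of a b] by blast
    ultimately have "embeds_chain_sum 3 1 A r"
      using embeds_chain_sum_listsI[OF po, of "[a, b, c]" "[d]"] that carr
      by (auto simp: numeral_3_eq_3)
    with no31 show False ..
  qed
  show ?thesis
    using xy two_two three_one unfolding trace_preorder_def by blast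
qed

section \<open>Compatible total preorders and quotient orders\<close>

text \<open>
  By invariance, \<open>x\<close> and \<open>y\<close> are equivalent under the preorder iff \<open>y \<otimes> inv x\<close> is equivalent to
  \<open>\<one>\<close>. Hence the equivalence classes are the cosets of the class \<open>H\<close> of \<open>\<one>\<close>, and the preorder
  descends to \<open>G Mod H\<close>.
\<close>

lemma (in group) totally_orderable_quotient_of_preorder:
  assumes q_carrier: "q \<subseteq> carrier G \<times> carrier G" and trans: "trans q"
    and total: "\<And>x y. x \<in> carrier G \<Longrightarrow> y \<in> carrier G \<Longrightarrow> (x, y) \<in> q \<or> (y, x) \<in> q"
    and left: "\<And>x y z. (x, y) \<in> q \<Longrightarrow> z \<in> carrier G \<Longrightarrow> (z \<otimes> x, z \<otimes> y) \<in> q"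
    and right: "\<And>x y z. (x, y) \<in> q \<Longrightarrow> z \<in> carrier G \<Longrightarrow> (x \<otimes> z, y \<otimes> z) \<in> q"
    and nontrivial: "q \<noteq> carrier G \<times> carrier G"
  shows "\<exists>H. H \<lhd> G \<and> H \<noteq> carrier G \<and> totally_orderable (G Mod H)"
proof -
  define H where "H = {h \<in> carrier G. (\<one>, h) \<in> q \<and> (h, \<one>) \<in> q}"
  have tr: "(a, c) \<in> q" if "(a, b) \<in> q" "(b, c) \<in> q" for a b c
    using trans that by (rule transD)
  have sub: "subgroup H G"
  proof (rule subgroupI)
    show "H \<subseteq> carrier G" by (auto simp: H_def)
    show "H \<noteq> {}" using total[of \<one> \<one>] by (auto simp: H_def)
    fix a assume a: "a \<in> H"
    show "inv a \<in> H"
      using a left[of \<one> a "inv a"] left[of a \<one> "inv a"] by (auto simp: H_def)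
    fix b assume b: "b \<in> H"
    show "a \<otimes> b \<in> H"
      using a b left[of \<one> b a] left[of b \<one> a]
        tr[of \<one> a "a \<otimes> b"] tr[of "a \<otimes> b" a \<one>] by (auto simp: H_def)
  qed
  have normal: "H \<lhd> G"
  proof (rule normal_invI[OF sub])
    fix x h assume x: "x \<in> carrier G" and h: "h \<in> H"
    show "x \<otimes> h \<otimes> inv x \<in> H"
      using x h right[OF left[of \<one> h x], of "inv x"] right[OF left[of h \<one> x], of "inv x"]
      by (auto simp: H_def)
  qed
  have coset_eq: "H #> x = H #> y \<longleftrightarrow> (x, y) \<in> q \<and> (y, x) \<in> q"
    if x: "x \<in> carrier G" and y: "y \<in> carrier G" for x y
  proof -
    have "H #> x = H #> y \<longleftrightarrow> y \<otimes> inv x \<in> H"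
      using x y sub by (metis is_group rcos_self repr_independence subgroup.rcos_module)
    also have "\<dots> \<longleftrightarrow> (x, y) \<in> q \<and> (y, x) \<in> q"
      using x y right[of \<one> "y \<otimes> inv x" x] right[of "y \<otimes> inv x" \<one> x]
        right[of x y "inv x"] right[of y x "inv x"]
      by (auto simp: H_def m_assoc)
    finally show ?thesis .
  qed
  have proper: "H \<noteq> carrier G"
  proof
    assume all: "H = carrier G"
    have "(x, y) \<in> q" if "x \<in> carrier G" "y \<in> carrier G" for x y
      using that coset_eq[OF that] coset_join2[OF _ sub] all by metis
    then show False
      using nontrivial q_carrier by auto
  qed
  define s where "s = {(H #> x, H #> y) |x y. (x, y) \<in> q}"
  \<comment> \<open>The relation between cosets does not depend on the representatives.\<close>
  have s_iff: "(H #> x, H #> y) \<in> s \<longleftrightarrow> (x, y) \<in> q"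
    if "x \<in> carrier G" "y \<in> carrier G" for x y
  proof
    assume "(H #> x, H #> y) \<in> s"
    then obtain x' y' where *: "H #> x = H #> x'" "H #> y = H #> y'" "(x', y') \<in> q"
      by (auto simp: s_def)
    moreover have "x' \<in> carrier G" "y' \<in> carrier G"
      using *(3) q_carrier by auto
    ultimately show "(x, y) \<in> q"
      using that coset_eq tr by meson
  qed (auto simp: s_def)
  have carr: "carrier (G Mod H) = (\<lambda>x. H #> x) ` carrier G"
    by (auto simp: FactGroup_def RCOSETS_def)
  have mult: "(H #> x) \<otimes>\<^bsub>G Mod H\<^esub> (H #> y) = H #> (x \<otimes> y)"
    if "x \<in> carrier G" "y \<in> carrier G" for x y
    using normal.rcos_sum[OF normal that] by (simp add: FactGroup_def)
  have lin: "linear_order_on (carrier (G Mod H)) s"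
    unfolding linear_order_on_def partial_order_on_def preorder_on_def
  proof (intro conjI)
    show "s \<subseteq> carrier (G Mod H) \<times> carrier (G Mod H)"
      using q_carrier by (auto simp: carr s_def)
    have s_sub: "\<exists>x y. x \<in> carrier G \<and> y \<in> carrier G \<and> X = H #> x \<and> Y = H #> y \<and> (x, y) \<in> q"
      if "(X, Y) \<in> s" for X Y
      using that q_carrier unfolding s_def by blast
    show "refl_on (carrier (G Mod H)) s"
      using total by (auto simp: refl_on_def carr s_iff)
    show "Relation.trans s"
    proof (rule transI)
      fix X Y Z assume XY: "(X, Y) \<in> s" and YZ: "(Y, Z) \<in> s"
      obtain x y z where "x \<in> carrier G" "y \<in> carrier G" "z \<in> carrier G"
        "X = H #> x" "Y = H #> y" "Z = H #> z"
        using s_sub[OF XY] s_sub[OF YZ] by blast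
      then show "(X, Z) \<in> s"
        using XY YZ tr s_iff by blast
    qed
    show "antisym s"
    proof (rule antisymI)
      fix X Y assume XY: "(X, Y) \<in> s" and YX: "(Y, X) \<in> s"
      obtain x y where "x \<in> carrier G" "y \<in> carrier G" "X = H #> x" "Y = H #> y"
        using s_sub[OF XY] by blast
      then show "X = Y"
        using XY YX s_iff coset_eq by blast
    qed
    show "total_on (carrier (G Mod H)) s"
      using total by (auto simp: total_on_def carr s_iff)
  qed
  have "compatible_order (G Mod H) s"
    using lin left right
    by (auto simp: compatible_order_def linear_order_on_def carr mult s_iff simp del: mult_FactGroup)
  with lin have "totally_orderable (G Mod H)"
    by (auto simp: totally_orderable_def)
  with normal proper show ?thesis by blast
qed

section \<open>From semiorders to quotients and back\<close>

text \<open>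
  Translations are automorphisms of the semiorder and therefore of its trace: \<open>inv g\<close> carries the
  points below \<open>g \<otimes> x\<close> to points below \<open>x\<close>, which are below \<open>y\<close>, and \<open>g\<close> carries them back; the
  points above, and translations on the right, are treated alike. The resulting normal subgroup is
  proper because a strict inequality of the semiorder remains strict in the trace.
\<close>

lemma (in group) compatible_semiorder_imp_quotient:
  assumes comp: "compatible_order G r" and semi: "semiorder_on (carrier G) r"
    and ne: "r \<noteq> Id_on (carrier G)"
  shows "\<exists>H. H \<lhd> G \<and> H \<noteq> carrier G \<and> totally_orderable (G Mod H)"
proof (rule totally_orderable_quotient_of_preorder)
  let ?q = "trace_preorder (carrier G) r" and ?s = "r - Id"
  have po: "partial_order_on (carrier G) r"
    using semi by (simp add: semiorder_on_def)
  have r_carr: "a \<in> carrier G \<and> b \<in> carrier G" if "(a, b) \<in> r" for a b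
    using po that by (auto simp: partial_order_on_def preorder_on_def)
  have s_left: "(g \<otimes> a, g \<otimes> b) \<in> ?s" and s_right: "(a \<otimes> g, b \<otimes> g) \<in> ?s"
    if "(a, b) \<in> ?s" "g \<in> carrier G" for a b g
    using that r_carr[of a b] comp by (auto simp: compatible_order_def)
  show "?q \<subseteq> carrier G \<times> carrier G"
    by (auto simp: trace_preorder_def)
  show "Relation.trans ?q"
    by (rule transI) (simp add: trace_preorder_def)
  show "(x, y) \<in> ?q \<or> (y, x) \<in> ?q" if "x \<in> carrier G" "y \<in> carrier G" for x y
    using trace_preorder_total[OF semi that] .
  show "(g \<otimes> x, g \<otimes> y) \<in> ?q" if q: "(x, y) \<in> ?q" and g: "g \<in> carrier G" for x y g
  proof -
    have xy: "x \<in> carrier G" "y \<in> carrier G"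
      using q by (auto simp: trace_preorder_def)
    have "(z, g \<otimes> y) \<in> ?s" if z: "(z, g \<otimes> x) \<in> ?s" for z
    proof -
      have zc: "z \<in> carrier G" using z r_carr by blast
      have "(inv g \<otimes> z, x) \<in> ?s"
        using s_left[OF z, of "inv g"] g xy by (simp add: m_assoc[symmetric])
      then have "(inv g \<otimes> z, y) \<in> ?s"
        using q by (simp add: trace_preorder_def)
      then show ?thesis
        using s_left[of "inv g \<otimes> z" y g] g zc by (simp add: m_assoc[symmetric])
    qed
    moreover have "(g \<otimes> x, z) \<in> ?s" if z: "(g \<otimes> y, z) \<in> ?s" for z
    proof -
      have zc: "z \<in> carrier G" using z r_carr by blast
      have "(y, inv g \<otimes> z) \<in> ?s"
        using s_left[OF z, of "inv g"] g xy by (simp add: m_assoc[symmetric])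
      then have "(x, inv g \<otimes> z) \<in> ?s"
        using q by (simp add: trace_preorder_def)
      then show ?thesis
        using s_left[of x "inv g \<otimes> z" g] g zc by (simp add: m_assoc[symmetric])
    qed
    ultimately show ?thesis
      using xy g unfolding trace_preorder_def by blast
  qed
  show "(x \<otimes> g, y \<otimes> g) \<in> ?q" if q: "(x, y) \<in> ?q" and g: "g \<in> carrier G" for x y g
  proof -
    have xy: "x \<in> carrier G" "y \<in> carrier G"
      using q by (auto simp: trace_preorder_def)
    have "(z, y \<otimes> g) \<in> ?s" if z: "(z, x \<otimes> g) \<in> ?s" for z
    proof -
      have zc: "z \<in> carrier G" using z r_carr by blast
      have "(z \<otimes> inv g, x) \<in> ?s"
        using s_right[OF z, of "inv g"] g xy by (simp add: m_assoc)
      then have "(z \<otimes> inv g, y) \<in> ?s"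
        using q by (simp add: trace_preorder_def)
      then show ?thesis
        using s_right[of "z \<otimes> inv g" y g] g zc by (simp add: m_assoc)
    qed
    moreover have "(x \<otimes> g, z) \<in> ?s" if z: "(y \<otimes> g, z) \<in> ?s" for z
    proof -
      have zc: "z \<in> carrier G" using z r_carr by blast
      have "(y, z \<otimes> inv g) \<in> ?s"
        using s_right[OF z, of "inv g"] g xy by (simp add: m_assoc)
      then have "(x, z \<otimes> inv g) \<in> ?s"
        using q by (simp add: trace_preorder_def)
      then show ?thesis
        using s_right[of x "z \<otimes> inv g" g] g zc by (simp add: m_assoc)
    qed
    ultimately show ?thesis
      using xy g unfolding trace_preorder_def by blast
  qed
  show "?q \<noteq> carrier G \<times> carrier G"
  proof -
    have "Id_on (carrier G) \<subseteq> r"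
      using po by (auto simp: partial_order_on_def preorder_on_def refl_on_def)
    then obtain a b where "(a, b) \<in> r" "(a, b) \<notin> Id_on (carrier G)"
      using ne by auto
    then have ab: "(a, b) \<in> ?s" and "a \<in> carrier G" "b \<in> carrier G"
      using r_carr by auto
    \<comment> \<open>\<open>a\<close> is strictly below \<open>b\<close> but not strictly below itself.\<close>
    moreover have "(b, a) \<notin> ?q"
      using ab by (auto simp: trace_preorder_def)
    ultimately show ?thesis by blast
  qed
qed

text \<open>
  The strict order of the quotient is pulled back along the projection. Translations preserve
  strictness because the quotient is cancellative. An embedded \<open>1 \<oplus> 2\<close> would have its isolated point
  in the coset of each element of the two-element chain, while comparable distinct elements lie in
  different cosets.
\<close>

lemma (in group) quotient_imp_compatible_weak_order:
  assumes normal: "H \<lhd> G" and proper: "H \<noteq> carrier G" and ord: "totally_orderable (G Mod H)"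
  shows "\<exists>r. compatible_order G r \<and> weak_order_on (carrier G) r \<and> r \<noteq> Id_on (carrier G)"
proof -
  obtain s where comp: "compatible_order (G Mod H) s" and lin: "linear_order_on (carrier (G Mod H)) s"
    using ord by (auto simp: totally_orderable_def)
  have sub: "subgroup H G" using normal by (rule normal_imp_subgroup)
  define r where "r = Id_on (carrier G) \<union>
    {(x, y) \<in> carrier G \<times> carrier G. (H #> x, H #> y) \<in> s - Id}"
  have carr: "H #> x \<in> carrier (G Mod H)" if "x \<in> carrier G" for x
    using that by (auto simp: FactGroup_def RCOSETS_def)
  have mult: "(H #> x) \<otimes>\<^bsub>G Mod H\<^esub> (H #> y) = H #> (x \<otimes> y)"
    if "x \<in> carrier G" "y \<in> carrier G" for x y
    using normal.rcos_sum[OF normal that] by (simp add: FactGroup_def)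
  have total: "(H #> x, H #> y) \<in> s \<or> (H #> y, H #> x) \<in> s \<or> H #> x = H #> y"
    if "x \<in> carrier G" "y \<in> carrier G" for x y
    using lin carr[OF that(1)] carr[OF that(2)] by (auto simp: linear_order_on_def total_on_def)
  have s_trans: "Relation.trans s" and s_antisym: "antisym s"
    using lin by (auto simp: linear_order_on_def partial_order_on_def preorder_on_def)
  have po: "partial_order_on (carrier G) r"
    unfolding partial_order_on_def preorder_on_def
  proof (intro conjI)
    show "r \<subseteq> carrier G \<times> carrier G" "refl_on (carrier G) r"
      by (auto simp: r_def refl_on_def)
    have "Relation.trans (s - Id)"
      using s_trans s_antisym by (rule trans_diff_Id)
    then show "Relation.trans r"
      unfolding r_def trans_def by blast
    show "antisym r"
      using s_antisym unfolding r_def antisym_def by blast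
  qed
  have cancel: "H #> x = H #> y"
    if eq: "H #> (z \<otimes> x) = H #> (z \<otimes> y) \<or> H #> (x \<otimes> z) = H #> (y \<otimes> z)"
      and xyz: "x \<in> carrier G" "y \<in> carrier G" "z \<in> carrier G" for x y z
  proof -
    interpret Q: group "G Mod H" using normal by (rule normal.factorgroup_is_group)
    show ?thesis
      using eq xyz Q.Units_l_cancel[of "H #> z" "H #> x" "H #> y"]
        Q.right_cancel[of "H #> x" "H #> y" "H #> z"]
      by (auto simp: mult[symmetric] carr Q.Units_eq simp del: mult_FactGroup)
  qed
  have s_mult: "(H #> (z \<otimes> x), H #> (z \<otimes> y)) \<in> s - Id" "(H #> (x \<otimes> z), H #> (y \<otimes> z)) \<in> s - Id"
    if xy: "(H #> x, H #> y) \<in> s - Id" and xyz: "x \<in> carrier G" "y \<in> carrier G" "z \<in> carrier G"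
    for x y z
  proof -
    have "(H #> (z \<otimes> x), H #> (z \<otimes> y)) \<in> s \<and> (H #> (x \<otimes> z), H #> (y \<otimes> z)) \<in> s"
      using xy comp carr[OF xyz(1)] carr[OF xyz(2)] carr[OF xyz(3)]
      unfolding compatible_order_def mult[OF xyz(3,1), symmetric] mult[OF xyz(3,2), symmetric]
        mult[OF xyz(1,3), symmetric] mult[OF xyz(2,3), symmetric] by blast
    moreover have "H #> (z \<otimes> x) \<noteq> H #> (z \<otimes> y)" "H #> (x \<otimes> z) \<noteq> H #> (y \<otimes> z)"
      using xy cancel[OF _ xyz] by blast+
    ultimately show "(H #> (z \<otimes> x), H #> (z \<otimes> y)) \<in> s - Id" "(H #> (x \<otimes> z), H #> (y \<otimes> z)) \<in> s - Id"
      by auto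
  qed
  have "compatible_order G r"
    using po s_mult by (auto simp: compatible_order_def r_def)
  moreover have "\<not> embeds_chain_sum 1 2 (carrier G) r"
  proof
    let ?C = "chain_sum_carrier 1 2"
    assume emb: "embeds_chain_sum 1 2 (carrier G) r"
    obtain f where f: "inj_on f ?C" "f ` ?C \<subseteq> carrier G"
      "\<And>x y. x \<in> ?C \<Longrightarrow> y \<in> ?C \<Longrightarrow> (f x, f y) \<in> r \<longleftrightarrow> (x, y) \<in> chain_sum_order 1 2"
      using emb by (rule embeds_chain_sumE) (rule that)
    define a b c where "a = f (Inl 0)" and "b = f (Inr 0)" and "c = f (Inr 1)"
    have C: "Inl 0 \<in> ?C" "Inr 0 \<in> ?C" "Inr 1 \<in> ?C"
      by (auto simp: chain_sum_carrier_def)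
    have abc: "a \<in> carrier G" "b \<in> carrier G" "c \<in> carrier G"
      using f(2) C by (auto simp: a_def b_def c_def)
    have "b \<noteq> c" 
      using inj_onD[OF f(1), of "Inr 0" "Inr 1"] C by (auto simp: b_def c_def)
    moreover have "(b, c) \<in> r" "(a, b) \<notin> r" "(b, a) \<notin> r" "(a, c) \<notin> r" "(c, a) \<notin> r"
      using f(3) C by (auto simp: a_def b_def c_def chain_sum_order_def)
    ultimately show False
      using abc total[of a b] total[of a c] by (auto simp: r_def)
  qed
  moreover have "r \<noteq> Id_on (carrier G)"
  proof -
    obtain x where x: "x \<in> carrier G" "x \<notin> H"
      using proper sub subgroup.subset by blast
    have ne: "H #> x \<noteq> H #> \<one>"
      using x sub by (metis coset_join1 coset_mult_one one_closed subgroup.subset rcos_self)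
    then have "(x, \<one>) \<in> r \<or> (\<one>, x) \<in> r"
      using total[of x \<one>] x by (auto simp: r_def)
    moreover have "x \<noteq> \<one>" using ne by auto
    ultimately show ?thesis by auto
  qed
  ultimately show ?thesis
    using po by (auto simp: weak_order_on_def)
qed

theorem proposition20:
  fixes G :: "('a, 'b) monoid_scheme"
  assumes "group G"
  shows "((\<exists>r. compatible_order G r \<and> semiorder_on (carrier G) r \<and> r \<noteq> Id_on (carrier G)) \<longleftrightarrow>
          (\<exists>r. compatible_order G r \<and> weak_order_on (carrier G) r \<and> r \<noteq> Id_on (carrier G)))
       \<and> ((\<exists>r. compatible_order G r \<and> weak_order_on (carrier G) r \<and> r \<noteq> Id_on (carrier G)) \<longleftrightarrow>
          (\<exists>H. H \<lhd> G \<and> H \<noteq> carrier G \<and> totally_orderable (G Mod H)))"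
  using group.compatible_semiorder_imp_quotient[OF assms]
    group.quotient_imp_compatible_weak_order[OF assms] weak_order_on_imp_semiorder_on
  by blast

end
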